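(* If $I\subset T_n$ is a nonzero monomial ideal which is a complete intersection, then $I$ is smoothly spreadable.
   Context: $K$ is a field, $T=K[x_1,x_2,\ldots]$ and $T_n=K[x_1,\ldots,x_n]$. For a monomial $u=x_{i_1}\cdots x_{i_d}$ with $i_1\le\cdots\le i_d$, set $\sigma(u):=x_{i_1}x_{i_2+1}\cdots x_{i_d+d-1}$, and $\sigma^t(u):=\sigma(\sigma^{t-1}(u))$, so $\sigma^t(u)=x_{i_1}x_{i_2+t}\cdots x_{i_d+(d-1)t}$. For a nonzero monomial ideal $I$, $G(I)$ is its set of minimal monomial generators and $\deg(I)$ is the maximal degree of an element of $G(I)$. For a monomial $u=x_1^{a_1}\cdots x_n^{a_n}\in T_n$, its polarization is $u^p:=\prod_{j=1}^n\prod_{k=0}^{a_j-1}x_{kn+j}$. A monomial ideal $I\subset T_n$ with $\deg(I)=d$ is smoothly spreadable if there is a permutation $\tau$ of $\{1,\ldots,nd\}$ with $\tau(j)\equiv j\pmod n$ for all $j$ such that the $K$-algebra isomorphism $\Phi:T_{nd}\to T_{nd}$, $\Phi(x_j)=x_{\tau(j)}$, satisfies $\Phi(\sigma^n(u))=u^p$ for all $u\in G(I)$. A monomial ideal with $G(I)=\{v_1,\ldots,v_m\}$ is a complete intersection if and only if $v_i$ and $v_j$ have disjoint supports (no common variable) for all $i\ne j$. *)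

theory Defs
  imports
    "HOL-Library.Multiset"
    "HOL-Library.Poly_Mapping"
    "HOL-Combinatorics.Permutations"
    "HOL-Number_Theory.Cong"
    "HOL-Algebra.QuotRing"
begin

text \<open>
  The monomial \<open>x\<^sub>i\<^sub>1 \<cdots> x\<^sub>i\<^sub>d\<close> is the multiset of its indices, so the product of
  monomials is \<open>+\<close>, divisibility is \<open>\<subseteq>#\<close>, the degree is \<open>size\<close> and the support is
  \<open>set_mset\<close>. A polynomial over \<open>K\<close> in \<open>x\<^sub>0, x\<^sub>1, x\<^sub>2, \<dots>\<close> is a finitely supported map from
  monomials to coefficients, multiplied by convolution; \<open>x\<^sub>0\<close> never occurs in \<open>T_ring n\<close>.
\<close>

type_synonym 'k pol = "nat multiset \<Rightarrow>\<^sub>0 'k"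

definition pmon :: "nat multiset \<Rightarrow> 'k::field pol"
  where "pmon u = Poly_Mapping.single u 1"

definition pconst :: "'k \<Rightarrow> 'k::field pol"
  where "pconst c = Poly_Mapping.single {#} c"

definition pvar :: "nat \<Rightarrow> 'k::field pol"
  where "pvar j = pmon {#j#}"

definition T_ring :: "nat \<Rightarrow> 'k::field pol ring"
  where "T_ring n = \<lparr>carrier = {f. \<forall>u \<in> Poly_Mapping.keys f. set_mset u \<subseteq> {1..n}},
               monoid.mult = (*), one = 1, zero = 0, add = (+)\<rparr>"

definition monomial_ideal :: "nat \<Rightarrow> 'k::field pol set \<Rightarrow> bool"
  where "monomial_ideal n I \<longleftrightarrow> ideal I (T_ring n) \<and>
    (\<exists>S. (\<forall>u \<in> S. set_mset u \<subseteq> {1..n}) \<and> I = genideal (T_ring n) (pmon ` S))"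

definition min_gens :: "'k::field pol set \<Rightarrow> nat multiset set"
  where "min_gens I = {u. pmon u \<in> I \<and> (\<forall>v. pmon v \<in> I \<longrightarrow> v \<subseteq># u \<longrightarrow> v = u)}"

lemma cring_T_ring: "cring (T_ring n :: 'k::field pol ring)"
proof (rule cringI)
  have keys_add: "set_mset u \<subseteq> {1..n}"
    if "\<forall>u \<in> Poly_Mapping.keys f. set_mset u \<subseteq> {1..n}"
       "\<forall>u \<in> Poly_Mapping.keys g. set_mset u \<subseteq> {1..n}"
       "u \<in> Poly_Mapping.keys (f + g)" for f g :: "'k pol" and u
    using that Poly_Mapping.keys_add[of f g] by blast
  show "abelian_group (T_ring n :: 'k pol ring)"
  proof (rule abelian_groupI, goal_cases)
    case (1 f g)
    then show ?case using keys_add[of f g] by (simp add: T_ring_def)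
  next
    case (6 f)
    then show ?case
      by (intro bexI[of _ "- f"]) (auto simp: T_ring_def)
  qed (auto simp: T_ring_def algebra_simps)
  show "comm_monoid (T_ring n :: 'k pol ring)"
  proof (rule comm_monoidI, goal_cases)
    case (1 f g)
    have "set_mset u \<subseteq> {1..n}" if u: "u \<in> Poly_Mapping.keys (f * g)" for u
    proof -
      obtain a b where "u = a + b" "a \<in> Poly_Mapping.keys f" "b \<in> Poly_Mapping.keys g"
        using Poly_Mapping.keys_mult[of f g] u by blast
      with 1 show ?thesis by (auto simp: T_ring_def)
    qed
    then show ?case by (auto simp: T_ring_def)
  qed (auto simp: T_ring_def algebra_simps)
qed (auto simp: T_ring_def algebra_simps)

lemma sum_singles:
  "(\<Sum>u\<in>Poly_Mapping.keys f. Poly_Mapping.single u (Poly_Mapping.lookup f u)) = f"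
  by (rule poly_mapping_eqI)
    (auto simp: lookup_sum lookup_single when_def in_keys_iff sum.delta cong: if_cong)

lemma mem_genideal_mon_iff:
  fixes S :: "nat multiset set"
  assumes S: "\<forall>u \<in> S. set_mset u \<subseteq> {1..n}"
  shows "genideal (T_ring n :: 'k::field pol ring) (pmon ` S) =
    {f \<in> carrier (T_ring n). \<forall>u \<in> Poly_Mapping.keys f. \<exists>s \<in> S. s \<subseteq># u}" (is "_ = ?J")
proof
  interpret R: cring "T_ring n :: 'k pol ring" by (rule cring_T_ring)
  have keys_mon: "Poly_Mapping.keys (pmon u :: 'k pol) = {u}" for u
    by (simp add: pmon_def)
  have "ideal ?J (T_ring n)"
  proof (rule idealI[OF R.ring_axioms])
    show "subgroup ?J (add_monoid (T_ring n))"
    proof (rule R.add.subgroupI, goal_cases)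
      case 2
      have "0 \<in> ?J" by (simp add: T_ring_def)
      then show ?case by blast
    next
      case (3 f)
      have "\<ominus>\<^bsub>T_ring n\<^esub> f = - f"
        by (rule R.minus_equality) (use 3 in \<open>auto simp: T_ring_def\<close>)
      then show ?case using 3 by (auto simp: T_ring_def a_inv_def)
    next
      case (4 f g)
      then have "f \<oplus>\<^bsub>T_ring n\<^esub> g \<in> carrier (T_ring n)" by blast
      moreover have "\<exists>s \<in> S. s \<subseteq># u" if "u \<in> Poly_Mapping.keys (f + g)" for u
        using that 4 Poly_Mapping.keys_add[of f g] by blast
      ultimately show ?case by (simp add: T_ring_def)
    qed auto
    have mult: "f * g \<in> ?J" if "f \<in> ?J" "g \<in> carrier (T_ring n)" for f g
    proof -
      have "f \<otimes>\<^bsub>T_ring n\<^esub> g \<in> carrier (T_ring n)" using that by blast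
      moreover have "\<exists>s \<in> S. s \<subseteq># u" if u: "u \<in> Poly_Mapping.keys (f * g)" for u
      proof -
        obtain a b where ab: "u = a + b" "a \<in> Poly_Mapping.keys f"
          using Poly_Mapping.keys_mult[of f g] u by blast
        then obtain s where "s \<in> S" "s \<subseteq># a" using \<open>f \<in> ?J\<close> by blast
        then show ?thesis using ab(1) by (metis subset_mset.le_add_same_cancel1 subset_mset.trans subset_mset.zero_le)
      qed
      ultimately show ?thesis by (simp add: T_ring_def)
    qed
    show "g \<otimes>\<^bsub>T_ring n\<^esub> f \<in> ?J" "f \<otimes>\<^bsub>T_ring n\<^esub> g \<in> ?J"
      if "f \<in> ?J" "g \<in> carrier (T_ring n)" for f g
      using mult[OF that] by (simp_all add: T_ring_def mult.commute)
  qed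
  moreover have "pmon ` S \<subseteq> ?J"
    using S by (auto simp: keys_mon T_ring_def)
  ultimately show "genideal (T_ring n) (pmon ` S) \<subseteq> ?J"
    by (rule R.genideal_minimal)
  have "pmon ` S \<subseteq> carrier (T_ring n :: 'k pol ring)"
    using S by (auto simp: keys_mon T_ring_def)
  then interpret I: ideal "genideal (T_ring n) (pmon ` S)" "T_ring n :: 'k pol ring"
    by (rule R.genideal_ideal)
  show "?J \<subseteq> genideal (T_ring n) (pmon ` S)"
  proof
    fix f :: "'k pol" assume f: "f \<in> ?J"
    have sum: "sum h A \<in> genideal (T_ring n) (pmon ` S)"
      if "finite A" "\<And>u. u \<in> A \<Longrightarrow> h u \<in> genideal (T_ring n) (pmon ` S)"
      for h :: "nat multiset \<Rightarrow> 'k pol" and A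
      using that
    proof (induction A rule: finite_induct)
      case empty
      show ?case using I.zero_closed by (simp add: T_ring_def)
    next
      case (insert x F)
      then show ?case using I.a_closed[of "h x" "sum h F"] by (simp add: T_ring_def)
    qed
    have "Poly_Mapping.single u c \<in> genideal (T_ring n) (pmon ` S)"
      if u: "u \<in> Poly_Mapping.keys f" for u and c :: 'k
    proof -
      obtain s where s: "s \<in> S" "s \<subseteq># u" using f u by blast
      have "(pmon s :: 'k pol) \<in> genideal (T_ring n) (pmon ` S)"
        using R.genideal_self[OF \<open>pmon ` S \<subseteq> carrier (T_ring n)\<close>] s(1) by blast
      moreover have "Poly_Mapping.single (u - s) c \<in> carrier (T_ring n)"
      proof -
        have "set_mset (u - s) \<subseteq> set_mset u" by (meson in_diffD subsetI)
        moreover have "set_mset u \<subseteq> {1..n}" using f u by (simp add: T_ring_def)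
        ultimately show ?thesis by (auto simp: T_ring_def)
      qed
      ultimately have "Poly_Mapping.single (u - s) c \<otimes>\<^bsub>T_ring n\<^esub> pmon s \<in> genideal (T_ring n) (pmon ` S)"
        by (rule I.I_l_closed)
      then show ?thesis using s(2)
        by (simp add: T_ring_def pmon_def Poly_Mapping.mult_single subset_mset.diff_add)
    qed
    then have "(\<Sum>u\<in>Poly_Mapping.keys f. Poly_Mapping.single u (Poly_Mapping.lookup f u))
      \<in> genideal (T_ring n) (pmon ` S)"
      by (intro sum) auto
    then show "f \<in> genideal (T_ring n) (pmon ` S)"
      by (simp add: sum_singles)
  qed
qed

text \<open>\<open>min_gens I\<close> generates \<open>I\<close>, and every set of monomials generating \<open>I\<close> contains it.\<close>

lemma min_gens_generate:
  assumes "monomial_ideal n I"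
  shows "genideal (T_ring n) (pmon ` min_gens I) = I"
    and "\<lbrakk>\<forall>u \<in> S. set_mset u \<subseteq> {1..n}; genideal (T_ring n) (pmon ` S) = I\<rbrakk> \<Longrightarrow> min_gens I \<subseteq> S"
proof -
  have mon_mem: "pmon u \<in> I \<longleftrightarrow> set_mset u \<subseteq> {1..n} \<and> (\<exists>s \<in> S. s \<subseteq># u)"
    if "\<forall>u \<in> S. set_mset u \<subseteq> {1..n}" "genideal (T_ring n) (pmon ` S) = I" for S u
    unfolding that(2)[symmetric] mem_genideal_mon_iff[OF that(1)]
    by (auto simp: T_ring_def pmon_def)
  show "min_gens I \<subseteq> S"
    if S: "\<forall>u \<in> S. set_mset u \<subseteq> {1..n}" "genideal (T_ring n) (pmon ` S) = I" for S
  proof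
    fix u assume u: "u \<in> min_gens I"
    then obtain s where s: "s \<in> S" "s \<subseteq># u"
      using mon_mem[OF S] by (auto simp: min_gens_def)
    then have "pmon s \<in> I" using mon_mem[OF S] S(1) by blast
    then show "u \<in> S" using u s by (auto simp: min_gens_def)
  qed
  obtain S where S: "\<forall>u \<in> S. set_mset u \<subseteq> {1..n}" "genideal (T_ring n) (pmon ` S) = I"
    using assms by (auto simp: monomial_ideal_def)
  have G: "\<forall>u \<in> min_gens I. set_mset u \<subseteq> {1..n}"
    using mon_mem[OF S] by (auto simp: min_gens_def)
  have below: "\<exists>v \<in> min_gens I. v \<subseteq># u" if "pmon u \<in> I" for u
    using that
  proof (induction "size u" arbitrary: u rule: less_induct)
    case less
    show ?case
    proof (cases "u \<in> min_gens I")
      case False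
      then obtain v where v: "pmon v \<in> I" "v \<subset># u"
        using less.prems by (auto simp: min_gens_def subset_mset.less_le)
      then obtain w where "w \<in> min_gens I" "w \<subseteq># v"
        using less.hyps[of v] mset_subset_size by blast
      then show ?thesis using v(2) by (meson subset_mset.less_imp_le subset_mset.trans)
    qed auto
  qed
  have "(\<exists>s \<in> S. s \<subseteq># u) \<longleftrightarrow> (\<exists>v \<in> min_gens I. v \<subseteq># u)" if "set_mset u \<subseteq> {1..n}" for u
    using below[of u] mon_mem[OF S] that
    by (metis (no_types, lifting) CollectD min_gens_def subset_mset.trans)
  then have "genideal (T_ring n :: 'a pol ring) (pmon ` min_gens I) = genideal (T_ring n) (pmon ` S)"
    unfolding mem_genideal_mon_iff[OF S(1)] mem_genideal_mon_iff[OF G]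
    by (auto simp: T_ring_def)
  then show "genideal (T_ring n) (pmon ` min_gens I) = I" using S(2) by simp
qed

text \<open>For a monomial ideal of \<open>T_ring n\<close> the set \<open>min_gens I\<close> is finite by Dickson's lemma, and
  nonempty if \<open>I\<close> is nonzero; only then is the maximum meaningful.\<close>

definition ideal_deg :: "'k::field pol set \<Rightarrow> nat"
  where "ideal_deg I = Max (size ` min_gens I)"

text \<open>Only for monomial ideals, where being a complete intersection amounts to the minimal
  monomial generators having pairwise disjoint supports.\<close>

definition complete_intersection :: "'k::field pol set \<Rightarrow> bool"
  where "complete_intersection I \<longleftrightarrow>
    (\<forall>u \<in> min_gens I. \<forall>v \<in> min_gens I. u \<noteq> v \<longrightarrow> set_mset u \<inter> set_mset v = {})"

text \<open>The index \<open>k\<close> counts from 0, so the factor \<open>x\<^sub>i\<close> in position \<open>k + 1\<close> becomes \<open>x\<close> with index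
  \<open>i + k\<close>.\<close>

definition sigma :: "nat multiset \<Rightarrow> nat multiset"
  where "sigma u = (let xs = sorted_list_of_multiset u
                    in mset (map (\<lambda>k. xs ! k + k) [0..<length xs]))"

definition polarization :: "nat \<Rightarrow> nat multiset \<Rightarrow> nat multiset"
  where "polarization n u = (\<Sum>j\<in>{1..n}. \<Sum>k<count u j. {#k * n + j#})"

definition K_algebra_iso :: "('k::field pol \<Rightarrow> 'k pol) \<Rightarrow> nat \<Rightarrow> nat \<Rightarrow> bool"
  where "K_algebra_iso \<Phi> m n \<longleftrightarrow> \<Phi> \<in> ring_iso (T_ring m) (T_ring n) \<and> (\<forall>c. \<Phi> (pconst c) = pconst c)"

definition smoothly_spreadable :: "nat \<Rightarrow> 'k::field pol set \<Rightarrow> bool"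
  where "smoothly_spreadable n I \<longleftrightarrow>
    (\<exists>\<tau> (\<Phi> :: 'k pol \<Rightarrow> 'k pol). \<tau> permutes {1..n * ideal_deg I} \<and>
           (\<forall>j \<in> {1..n * ideal_deg I}. [\<tau> j = j] (mod n)) \<and>
           K_algebra_iso \<Phi> (n * ideal_deg I) (n * ideal_deg I) \<and>
           (\<forall>j \<in> {1..n * ideal_deg I}. \<Phi> (pvar j) = pvar (\<tau> j)) \<and>
           (\<forall>u \<in> min_gens I. \<Phi> (pmon ((sigma ^^ n) u)) = pmon (polarization n u)))"

end

theory Submission
  imports Defs
begin

text \<open>
  The proof compares, variable by variable, how the two squarefree monomials \<open>\<sigma>\<^sup>n(u)\<close> and \<open>u\<^sup>p\<close>
  sit in the residue classes modulo \<open>n\<close>. Let \<open>m\<close> be the number of factors of \<open>u\<close> with index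
  below \<open>j\<close>, and let \<open>a\<close> be the exponent of \<open>x\<^sub>j\<close> in \<open>u\<close>. In the sorted factorization of \<open>u\<close> the
  factors \<open>x\<^sub>j\<close> form one block, in the positions \<open>m, \<dots>, m + a - 1\<close> counted from 0. So \<open>\<sigma>\<^sup>n(u)\<close>
  has, in the class of \<open>j\<close>, exactly the indices \<open>j + (m + c) n\<close> with \<open>c < a\<close>, whereas \<open>u\<^sup>p\<close> has
  the indices \<open>j + c n\<close> with \<open>c < a\<close> (\<open>mset_map_nth_by_blocks\<close>, \<open>funpow_sigma\<close>). With
  \<open>d = deg(I) \<ge> m + a\<close>, the class of \<open>j\<close> in \<open>{1, \<dots>, nd}\<close> is a copy of \<open>\<int>/d\<close>, and rotating it
  back by \<open>m\<close> carries the first set to the second.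

  The number \<open>m\<close> depends on \<open>u\<close>, so for a general ideal the rotations required by different
  generators can conflict. For a complete intersection they cannot: a variable \<open>x\<^sub>j\<close> divides at
  most one generator, which alone determines the rotation of the class of \<open>j\<close>. The rotations
  of all classes together form the permutation \<open>\<tau>\<close> (\<open>rotate_classes_permutes\<close>), and renaming
  variables along \<open>\<tau>\<close> is an automorphism of the polynomial ring (\<open>K_algebra_iso_rename_vars\<close>).
\<close>

section \<open>Renaming variables\<close>

text \<open>
  The coefficient of \<open>u\<close> in the result is the coefficient of the preimage of \<open>u\<close>, hence the
  inverse; this is meaningful for bijective \<open>\<tau>\<close> only.
\<close>

definition rename_vars :: "(nat \<Rightarrow> nat) \<Rightarrow> 'k::field pol \<Rightarrow> 'k pol"
  where "rename_vars \<tau> = Poly_Mapping.map_key (image_mset (inv_into UNIV \<tau>))"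

lemma inj_image_mset_inv:
  assumes "bij \<tau>"
  shows "inj (image_mset (inv_into UNIV \<tau>))"
  by (rule inj_on_inverseI[where g = "image_mset \<tau>"])
    (use assms in \<open>simp add: multiset.map_comp o_def bij_is_surj surj_f_inv_f\<close>)

lemma rename_vars_single:
  assumes "bij \<tau>"
  shows "rename_vars \<tau> (Poly_Mapping.single u c) = Poly_Mapping.single (image_mset \<tau> u) c"
proof -
  have "image_mset (inv_into UNIV \<tau>) (image_mset \<tau> u) = u"
    using assms by (simp add: multiset.map_comp bij_is_inj)
  then show ?thesis
    using map_key_single[OF inj_image_mset_inv[OF assms], of "image_mset \<tau> u" c]
    by (simp add: rename_vars_def)
qed

lemma rename_vars_add:
  assumes "bij \<tau>"
  shows "rename_vars \<tau> (f + g) = rename_vars \<tau> f + rename_vars \<tau> g"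
  unfolding rename_vars_def by (rule map_key_plus[OF inj_image_mset_inv[OF assms]])

lemma rename_vars_sum:
  assumes "bij \<tau>"
  shows "rename_vars \<tau> (\<Sum>a\<in>A. f a) = (\<Sum>a\<in>A. rename_vars \<tau> (f a))"
proof -
  have "rename_vars \<tau> (0 :: 'a pol) = 0"
    using rename_vars_single[OF assms, of "{#}" 0] by simp
  then show ?thesis
    by (induction A rule: infinite_finite_induct) (simp_all add: rename_vars_add[OF assms])
qed

lemma rename_vars_mult:
  assumes "bij \<tau>"
  shows "rename_vars \<tau> (f * g) = rename_vars \<tau> f * rename_vars \<tau> g"
proof -
  let ?t = "\<lambda>f u. Poly_Mapping.single u (Poly_Mapping.lookup f u)"
  have "rename_vars \<tau> ((\<Sum>u\<in>A. ?t f u) * (\<Sum>v\<in>B. ?t g v))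
      = rename_vars \<tau> (\<Sum>u\<in>A. ?t f u) * rename_vars \<tau> (\<Sum>v\<in>B. ?t g v)" for A B
    by (simp add: sum_product rename_vars_sum[OF assms] rename_vars_single[OF assms] mult_single)
  from this[of "Poly_Mapping.keys f" "Poly_Mapping.keys g"] show ?thesis
    by (simp add: sum_singles)
qed

lemma rename_vars_inv:
  assumes "bij \<tau>"
  shows "rename_vars (inv_into UNIV \<tau>) (rename_vars \<tau> f) = f"
proof -
  have bij': "bij (inv_into UNIV \<tau>)" using assms by (rule bij_imp_bij_inv)
  have "rename_vars (inv_into UNIV \<tau>) (rename_vars \<tau> (\<Sum>u\<in>A. Poly_Mapping.single u (Poly_Mapping.lookup f u)))
      = (\<Sum>u\<in>A. Poly_Mapping.single u (Poly_Mapping.lookup f u))" for A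
    using assms
    by (simp add: rename_vars_sum rename_vars_single bij' multiset.map_comp bij_is_inj)
  from this[of "Poly_Mapping.keys f"] show ?thesis by (simp add: sum_singles)
qed

lemma rename_vars_closed:
  assumes "\<tau> permutes {1..N}" "f \<in> carrier (T_ring N)"
  shows "rename_vars \<tau> f \<in> carrier (T_ring N)"
proof -
  have "set_mset u \<subseteq> {1..N}" if "u \<in> Poly_Mapping.keys (rename_vars \<tau> f)" for u
  proof -
    have "image_mset (inv_into UNIV \<tau>) u \<in> Poly_Mapping.keys f"
      using that keys_map_key[OF inj_image_mset_inv[OF permutes_bij[OF assms(1)]], of f]
      by (simp add: rename_vars_def)
    then have "inv_into UNIV \<tau> ` set_mset u \<subseteq> {1..N}"
      using assms(2) by (force simp: T_ring_def)
    then show ?thesis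
      using permutes_in_image[OF permutes_inv[OF assms(1)]] by blast
  qed
  then show ?thesis by (simp add: T_ring_def)
qed

lemma K_algebra_iso_rename_vars:
  assumes "\<tau> permutes {1..N}"
  shows "K_algebra_iso (rename_vars \<tau> :: 'k::field pol \<Rightarrow> 'k pol) N N"
proof -
  note bij = permutes_bij[OF assms]
  have bij': "bij (inv_into UNIV \<tau>)" using bij by (rule bij_imp_bij_inv)
  have const: "rename_vars \<tau> (pconst c) = (pconst c :: 'k pol)" for c
    by (simp add: pconst_def rename_vars_single[OF bij])
  have one: "rename_vars \<tau> (1 :: 'k pol) = 1"
    using const[of 1] by (simp add: pconst_def)
  have "rename_vars \<tau> \<in> ring_hom (T_ring N :: 'k pol ring) (T_ring N)"
    by (rule ring_hom_memI)
      (simp_all add: rename_vars_closed[OF assms] T_ring_def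
        rename_vars_mult[OF bij] rename_vars_add[OF bij] one
        rename_vars_closed[OF assms, unfolded T_ring_def, simplified])
  moreover have "bij_betw (rename_vars \<tau>) (carrier (T_ring N :: 'k pol ring)) (carrier (T_ring N))"
    by (rule bij_betw_byWitness[where f' = "rename_vars (inv_into UNIV \<tau>)"])
      (use rename_vars_inv[OF bij] rename_vars_inv[OF bij'] rename_vars_closed[OF assms]
          rename_vars_closed[OF permutes_inv[OF assms]] in \<open>auto simp: inv_inv_eq[OF bij]\<close>)
  ultimately show ?thesis
    by (simp add: K_algebra_iso_def ring_iso_def const)
qed

section \<open>Rotating residue classes\<close>

text \<open>
  The number \<open>j + k n\<close> with \<open>1 \<le> j \<le> n\<close> and \<open>k < d\<close> goes to \<open>j + ((k + s j) mod d) n\<close>. The shift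
  \<open>- 1\<close> is needed since the residues are represented by \<open>1, \<dots>, n\<close>.
\<close>

definition rotate_classes :: "nat \<Rightarrow> nat \<Rightarrow> (nat \<Rightarrow> nat) \<Rightarrow> nat \<Rightarrow> nat"
  where "rotate_classes n d s x =
    (if x \<in> {1..n * d}
     then let j = Suc ((x - 1) mod n) in j + (((x - 1) div n + s j) mod d) * n
     else x)"

lemma rotate_classes_apply:
  assumes "j \<in> {1..n}" "k < d"
  shows "rotate_classes n d s (j + k * n) = j + ((k + s j) mod d) * n"
proof -
  obtain i where i: "j = Suc i" "i < n"
    using assms(1) by (cases j) auto
  have "Suc i + k * n \<le> (k + 1) * n" using i by simp
  also have "\<dots> \<le> d * n" using assms(2) by (intro mult_le_mono1) simp
  finally show ?thesis
    using i by (simp add: rotate_classes_def mult.commute)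
qed

lemma class_coordinates:
  fixes x :: nat
  assumes "x \<in> {1..n * d}"
  obtains j k where "j \<in> {1..n}" "k < d" "x = j + k * n"
proof
  have "n > 0" using assms by (cases n) auto
  then show "Suc ((x - 1) mod n) \<in> {1..n}" by (simp add: Suc_leI)
  show "(x - 1) div n < d"
    using assms by (intro less_mult_imp_div_less) (auto simp: mult.commute)
  have "(x - 1) mod n + (x - 1) div n * n = x - 1" by simp
  then show "x = Suc ((x - 1) mod n) + (x - 1) div n * n" using assms by simp
qed

lemma class_coordinates_unique:
  fixes j :: nat
  assumes "j \<in> {1..n}" "j' \<in> {1..n}" "j + k * n = j' + k' * n"
  shows "j = j' \<and> k = k'"
proof -
  obtain i i' where i: "j = Suc i" "i < n" "j' = Suc i'" "i' < n"
    using assms(1,2) by (cases j; cases j') auto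
  then have eq: "i + k * n = i' + k' * n" using assms(3) by simp
  have "i = i'" using arg_cong[OF eq, of "\<lambda>x. x mod n"] i by simp
  then show ?thesis using eq i by auto
qed

lemma rotate_classes_cong:
  assumes "x \<in> {1..n * d}"
  shows "[rotate_classes n d s x = x] (mod n)"
proof -
  obtain j k where "j \<in> {1..n}" "k < d" "x = j + k * n"
    using class_coordinates[OF assms] .
  then show ?thesis by (simp add: rotate_classes_apply cong_def)
qed

lemma rotate_classes_permutes: "rotate_classes n d s permutes {1..n * d}"
proof -
  let ?\<tau> = "rotate_classes n d s"
  have "inj_on ?\<tau> {1..n * d}"
  proof (rule inj_onI)
    fix x x' assume x: "x \<in> {1..n * d}" "x' \<in> {1..n * d}" and eq: "?\<tau> x = ?\<tau> x'"
    obtain j k where jk: "j \<in> {1..n}" "k < d" "x = j + k * n"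
      using class_coordinates[OF x(1)] .
    obtain j' k' where jk': "j' \<in> {1..n}" "k' < d" "x' = j' + k' * n"
      using class_coordinates[OF x(2)] .
    have "j = j' \<and> (k + s j) mod d = (k' + s j') mod d"
      using eq jk jk' by (intro class_coordinates_unique) (simp_all add: rotate_classes_apply)
    then have "j = j'" "[k + s j = k' + s j] (mod d)" by (auto simp: cong_def)
    moreover from this have "k = k'"
      using jk(2) jk'(2) by (auto simp: cong_add_rcancel_nat intro: cong_less_modulus_unique_nat)
    ultimately show "x = x'" using jk jk' by simp
  qed
  moreover have "?\<tau> ` {1..n * d} \<subseteq> {1..n * d}"
  proof (rule image_subsetI)
    fix x assume "x \<in> {1..n * d}"
    then obtain j k where jk: "j \<in> {1..n}" "k < d" "x = j + k * n"
      using class_coordinates by metis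
    have "(k + s j) mod d + 1 \<le> d" using jk(2) by (simp add: Suc_leI)
    then have "((k + s j) mod d + 1) * n \<le> d * n" by (rule mult_le_mono1)
    then show "?\<tau> x \<in> {1..n * d}"
      using jk by (simp add: rotate_classes_apply mult.commute)
  qed
  ultimately have "bij_betw ?\<tau> {1..n * d} {1..n * d}"
    by (simp add: bij_betw_def endo_inj_surj)
  then show ?thesis
    by (rule bij_imp_permutes) (auto simp: rotate_classes_def)
qed

section \<open>Blocks of equal factors\<close>

text \<open>
  In a sorted list the copies of \<open>j\<close> occupy consecutive positions, starting at the number of
  entries below \<open>j\<close>. The induction appends a new maximum \<open>y\<close>: no entry exceeds \<open>y\<close>, so the blocks
  that exist keep their positions and the block of \<open>y\<close> grows by one at its end.
\<close>

lemma mset_map_nth_by_blocks: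
  fixes xs :: "'a::linorder list"
  assumes "sorted xs" "set xs \<subseteq> A" "finite A"
  shows "mset (map (\<lambda>k. g (xs ! k) k) [0..<length xs])
    = (\<Sum>j\<in>A. \<Sum>c<count (mset xs) j. {#g j (size (filter_mset (\<lambda>i. i < j) (mset xs)) + c)#})"
  using assms(1,2)
proof (induction xs rule: rev_induct)
  case (snoc y xs)
  have le: "\<forall>x\<in>set xs. x \<le> y" and "sorted xs"
    using snoc.prems(1) by (auto simp: sorted_append)
  let ?b = "\<lambda>zs j. size (filter_mset (\<lambda>i. i < j) (mset zs))"
  have "filter_mset (\<lambda>i. \<not> i < y) (mset xs) = filter_mset (\<lambda>i. i = y) (mset xs)"
    using le by (intro filter_mset_cong) auto
  then have len: "length xs = ?b xs y + count (mset xs) y"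
    using multiset_partition[of "mset xs" "\<lambda>i. i < y"]
    by (metis filter_eq_replicate_mset size_mset size_replicate_mset size_union)
  have blocks: "(\<Sum>c<count (mset (xs @ [y])) j. {#g j (?b (xs @ [y]) j + c)#})
      = (\<Sum>c<count (mset xs) j. {#g j (?b xs j + c)#}) + (if y = j then {#g y (length xs)#} else {#})"
    for j
  proof (cases "j \<le> y")
    case True
    then show ?thesis using len by auto
  next
    case False
    then have "count (mset xs) j = 0" using le by (auto simp: count_eq_zero_iff)
    then have "count (mset (xs @ [y])) j = 0" using False by simp
    with \<open>count (mset xs) j = 0\<close> show ?thesis using False by (simp only: lessThan_0 sum.empty) auto
  qed
  have "map (\<lambda>k. g ((xs @ [y]) ! k) k) [0..<length (xs @ [y])]
      = map (\<lambda>k. g (xs ! k) k) [0..<length xs] @ [g y (length xs)]"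
    by (simp add: nth_append)
  then have "mset (map (\<lambda>k. g ((xs @ [y]) ! k) k) [0..<length (xs @ [y])])
      = mset (map (\<lambda>k. g (xs ! k) k) [0..<length xs]) + {#g y (length xs)#}"
    by (simp only: mset_append mset.simps empty_neutral)
  also have "\<dots> = (\<Sum>j\<in>A. \<Sum>c<count (mset xs) j. {#g j (?b xs j + c)#})
      + (\<Sum>j\<in>A. if y = j then {#g y (length xs)#} else {#})"
    using snoc.IH[OF \<open>sorted xs\<close>] snoc.prems(2) assms(3) by (simp add: sum.delta)
  finally show ?case
    by (simp only: blocks sum.distrib)
qed simp

lemma funpow_sigma:
  "(sigma ^^ t) u = mset (map (\<lambda>k. sorted_list_of_multiset u ! k + k * t) [0..<size u])"
proof (induction t)
  case 0
  have "length (sorted_list_of_multiset u) = size u"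
    by (metis mset_sorted_list_of_multiset size_mset)
  then have "map (\<lambda>k. sorted_list_of_multiset u ! k) [0..<size u] = sorted_list_of_multiset u"
    using map_nth[of "sorted_list_of_multiset u"] by simp
  then show ?case by (simp del: mset_map)
next
  case (Suc t)
  let ?xs = "sorted_list_of_multiset u"
  let ?ys = "map (\<lambda>k. ?xs ! k + k * t) [0..<size u]"
  have len: "length ?xs = size u"
    by (metis mset_sorted_list_of_multiset size_mset)
  have "sorted ?ys"
    unfolding sorted_iff_nth_mono
    by (auto intro!: add_mono sorted_nth_mono simp: len)
  then have "sorted_list_of_multiset (mset ?ys) = ?ys"
    by (simp only: sorted_list_of_multiset_mset sorted_sort_id)
  then have "sigma (mset ?ys) = mset (map (\<lambda>k. ?ys ! k + k) [0..<length ?ys])"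
    by (simp only: sigma_def Let_def)
  also have "map (\<lambda>k. ?ys ! k + k) [0..<length ?ys] = map (\<lambda>k. ?xs ! k + k * Suc t) [0..<size u]"
    by simp
  finally show ?case using Suc by simp
qed

text \<open>
  A rotation of the class of \<open>j\<close> by \<open>d\<close> minus the start of its block moves the block to the
  front of the class, which is where the polarization has it.
\<close>

lemma rotate_classes_funpow_sigma:
  assumes u: "set_mset u \<subseteq> {1..n}" "size u \<le> d"
    and s: "\<And>j. j \<in># u \<Longrightarrow> s j = d - size (filter_mset (\<lambda>i. i < j) u)"
  shows "image_mset (rotate_classes n d s) ((sigma ^^ n) u) = polarization n u"
proof -
  let ?xs = "sorted_list_of_multiset u"
  let ?\<tau> = "rotate_classes n d s"
  let ?b = "\<lambda>j. size (filter_mset (\<lambda>i. i < j) u)"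
  have len: "length ?xs = size u"
    by (metis mset_sorted_list_of_multiset size_mset)
  have move: "?\<tau> (j + (?b j + c) * n) = c * n + j" if j: "j \<in> {1..n}" and c: "c < count u j" for j c
  proof -
    have "j \<in># u" using c by (metis count_inI not_less_zero)
    have "count u j \<le> size (filter_mset (\<lambda>i. \<not> i < j) u)"
      using count_le_size[of "filter_mset (\<lambda>i. \<not> i < j) u" j] by simp
    moreover have "size u = ?b j + size (filter_mset (\<lambda>i. \<not> i < j) u)"
      by (metis multiset_partition size_union)
    ultimately have "?b j + count u j \<le> d"
      using u(2) by linarith
    with c have "?b j + c < d" "(?b j + c + s j) mod d = c"
      by (simp_all add: s[OF \<open>j \<in># u\<close>])
    then show ?thesis using rotate_classes_apply[OF j] by (simp add: add.commute)
  qed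
  have "image_mset ?\<tau> ((sigma ^^ n) u) = mset (map (\<lambda>k. ?\<tau> (?xs ! k + k * n)) [0..<length ?xs])"
    by (simp add: funpow_sigma len multiset.map_comp o_def)
  also have "\<dots> = (\<Sum>j\<in>{1..n}. \<Sum>c<count u j. {#?\<tau> (j + (?b j + c) * n)#})"
    using mset_map_nth_by_blocks[of ?xs "{1..n}" "\<lambda>i k. ?\<tau> (i + k * n)"] u(1) by simp
  also have "\<dots> = polarization n u"
    unfolding polarization_def by (intro sum.cong refl) (simp add: move)
  finally show ?thesis .
qed

section \<open>Complete intersections\<close>

lemma min_gens_support:
  assumes "monomial_ideal n I" "u \<in> min_gens I"
  shows "set_mset u \<subseteq> {1..n}"
proof -
  have "pmon u \<in> carrier (T_ring n :: 'a pol ring)"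
    using assms by (auto simp: monomial_ideal_def min_gens_def dest: ideal.Icarr)
  then show ?thesis
    by (simp add: T_ring_def pmon_def)
qed

text \<open>
  Generators with pairwise disjoint supports are determined by their supports, and these are
  among the finitely many subsets of \<open>{1..n}\<close>.
\<close>

lemma finite_min_gens_complete_intersection:
  assumes "monomial_ideal n I" "complete_intersection I"
  shows "finite (min_gens I)"
proof (rule finite_imageD)
  have "set_mset ` min_gens I \<subseteq> Pow {1..n}"
    using min_gens_support[OF assms(1)] by auto
  then show "finite (set_mset ` min_gens I)"
    by (rule finite_subset) simp
  show "inj_on set_mset (min_gens I)"
  proof (rule inj_onI, rule ccontr)
    fix u v assume uv: "u \<in> min_gens I" "v \<in> min_gens I" "set_mset u = set_mset v" "u \<noteq> v"
    then have "set_mset u \<inter> set_mset v = {}"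
      using assms(2) unfolding complete_intersection_def by blast
    with uv(3) have "u = {#}" "v = {#}" by simp_all
    with uv(4) show False by simp
  qed
qed

theorem corollary1p11:
  fixes I :: "'k::field pol set" and n :: nat
  assumes "monomial_ideal n I"
    and "I \<noteq> {0}"
    and "complete_intersection I"
  shows "smoothly_spreadable n I"
proof -
  define d where "d = ideal_deg I"
  \<comment> \<open>For \<open>j\<close> outside all supports this is an unspecified value, which is harmless: there any
    rotation of the class of \<open>j\<close> will do.\<close>
  define gen where "gen j = (SOME u. u \<in> min_gens I \<and> j \<in># u)" for j
  define s where "s j = d - size (filter_mset (\<lambda>i. i < j) (gen j))" for j
  let ?\<tau> = "rotate_classes n d s"
  have perm: "?\<tau> permutes {1..n * d}" by (rule rotate_classes_permutes)
  have gen: "gen j = u" if "u \<in> min_gens I" "j \<in># u" for u j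
  proof -
    have "\<exists>v. v \<in> min_gens I \<and> j \<in># v" using that by blast
    then have "gen j \<in> min_gens I \<and> j \<in># gen j"
      unfolding gen_def by (rule someI_ex)
    then show ?thesis
      using assms(3) that by (auto simp: complete_intersection_def)
  qed
  have pol: "rename_vars ?\<tau> (pmon ((sigma ^^ n) u)) = (pmon (polarization n u) :: 'k pol)"
    if u: "u \<in> min_gens I" for u
  proof -
    have "size u \<le> d"
      using finite_min_gens_complete_intersection[OF assms(1,3)] u
      by (simp add: d_def ideal_deg_def)
    then have "image_mset ?\<tau> ((sigma ^^ n) u) = polarization n u"
      using min_gens_support[OF assms(1) u] gen[OF u]
      by (intro rotate_classes_funpow_sigma) (simp_all add: s_def)
    then show ?thesis
      by (simp add: pmon_def rename_vars_single[OF permutes_bij[OF perm]])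
  qed
  have var: "rename_vars ?\<tau> (pvar j) = (pvar (?\<tau> j) :: 'k pol)" for j
    by (simp add: pvar_def pmon_def rename_vars_single[OF permutes_bij[OF perm]])
  show ?thesis
    unfolding smoothly_spreadable_def d_def[symmetric]
    by (intro exI[where x = ?\<tau>] exI[where x = "rename_vars ?\<tau>"] conjI ballI perm
        rotate_classes_cong K_algebra_iso_rename_vars var pol)
qed

end
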